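(* Let $(S,U,A,C_1\cup C_2)$ be an instance of WSP, let $\approx_1$ be a plan-indistinguishability relation with respect to $C_1$ and $\approx_2$ a plan-indistinguishability relation with respect to $C_2$. Given an ordering $u_1,\dots,u_n$ of $U$, let $W_1$ be the width of $\approx_1$ (with respect to $C_1$) and $W_2$ the width of $\approx_2$ (with respect to $C_2$) with respect to $u_1,\dots,u_n$. Let $\approx$ be the relation on plans eligible with respect to $C_1\cup C_2$ given by $\pi\approx\pi'$ iff $\pi\approx_1\pi'$ and $\pi\approx_2\pi'$. Then $\approx$ is a plan-indistinguishability relation with respect to $C_1\cup C_2$, and $\approx$ has width at most $W_1W_2$ with respect to $u_1,\dots,u_n$.
   Context: An instance of WSP is a tuple $(S,U,A,C)$: $S$ a finite set of tasks, $U$ a finite set of users ($n=|U|$), $A(s)\subseteq U$ authorization lists, $C$ a set of constraints; a constraint is a pair $(L,\Theta)$ with $L\subseteq S$ and $\Theta$ a set of functions $L\to U$. A plan is a function $\pi:T\to X$ with $T\subseteq S$, $X\subseteq U$, where $\mathrm{task}(\pi)=T$ and $\mathrm{user}(\pi)=X$ are part of the data of $\pi$. $\pi$ satisfies $(L,\Theta)$ if $L\setminus T\neq\emptyset$ or $\pi|_L\in\Theta$; for a set of constraints $C'$, $\pi$ is $C'$-eligible if it satisfies every constraint of $C'$. Plans are disjoint if their task sets are disjoint and their user sets are disjoint; the union $\pi_1\cup\pi_2$ of disjoint plans has the union task and user sets and agrees with $\pi_i$ on $\mathrm{task}(\pi_i)$. $C'$-eligible plans $\pi_1,\pi_2$ are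 extension-equivalent (w.r.t. $C'$) if they have the same user and task sets and for every plan $\pi'$ disjoint from both, $\pi_1\cup\pi'$ is $C'$-eligible iff $\pi_2\cup\pi'$ is. A plan-indistinguishability relation with respect to $C'$ is an equivalence relation on $C'$-eligible plans refining extension-equivalence w.r.t. $C'$ such that if $\pi_1\approx\pi_2$ are $C'$-eligible and $\pi'$ is disjoint from both with $\pi_1\cup\pi'$ $C'$-eligible, then $\pi_1\cup\pi'\approx\pi_2\cup\pi'$. With $U_i=\{u_1,\dots,u_i\}$, the width of a relation $\approx$ on $C'$-eligible plans with respect to $u_1,\dots,u_n$ is the maximum over $i\in[n]$ and $T\subseteq S$ of the number of $\approx$-classes among the $C'$-eligible plans with user set $U_i$ and task set $T$. *)

theory Defs
  imports Main "HOL-Library.FuncSet"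
begin

text \<open>
  A constraint \<open>(L, \<Theta>)\<close>; functions on \<open>L\<close> are represented extensionally, i.e. as elements of
  \<open>L \<rightarrow>\<^sub>E U\<close>.
\<close>

type_synonym ('s, 'u) wsp_constraint = "'s set \<times> ('s \<Rightarrow> 'u) set"

definition wsp_instance ::
  "'s set \<Rightarrow> 'u set \<Rightarrow> ('s \<Rightarrow> 'u set) \<Rightarrow> ('s, 'u) wsp_constraint set \<Rightarrow> bool" where
  "wsp_instance S U A C \<longleftrightarrow>
     finite S \<and> finite U \<and> (\<forall>s\<in>S. A s \<subseteq> U) \<and>
     (\<forall>(L, \<Theta>)\<in>C. L \<subseteq> S \<and> \<Theta> \<subseteq> (L \<rightarrow>\<^sub>E U))"

text \<open>
  The user set is the codomain of the plan, not its image: a plan need not use all of its users.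
\<close>

record ('s, 'u) plan =
  task :: "'s set"
  user :: "'u set"
  assign :: "'s \<Rightarrow> 'u"

definition is_plan :: "'s set \<Rightarrow> 'u set \<Rightarrow> ('s, 'u) plan \<Rightarrow> bool" where
  "is_plan S U \<pi> \<longleftrightarrow> task \<pi> \<subseteq> S \<and> user \<pi> \<subseteq> U \<and> assign \<pi> \<in> task \<pi> \<rightarrow>\<^sub>E user \<pi>"

definition satisfies :: "('s, 'u) plan \<Rightarrow> ('s, 'u) wsp_constraint \<Rightarrow> bool" where
  "satisfies \<pi> c \<longleftrightarrow> (case c of (L, \<Theta>) \<Rightarrow> L - task \<pi> \<noteq> {} \<or> restrict (assign \<pi>) L \<in> \<Theta>)"

definition eligible :: "('s, 'u) wsp_constraint set \<Rightarrow> ('s, 'u) plan \<Rightarrow> bool" where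
  "eligible C \<pi> \<longleftrightarrow> (\<forall>c\<in>C. satisfies \<pi> c)"

definition eligible_plans ::
  "'s set \<Rightarrow> 'u set \<Rightarrow> ('s, 'u) wsp_constraint set \<Rightarrow> ('s, 'u) plan set" where
  "eligible_plans S U C = {\<pi>. is_plan S U \<pi> \<and> eligible C \<pi>}"

definition disjoint_plans :: "('s, 'u) plan \<Rightarrow> ('s, 'u) plan \<Rightarrow> bool" where
  "disjoint_plans \<pi>\<^sub>1 \<pi>\<^sub>2 \<longleftrightarrow> task \<pi>\<^sub>1 \<inter> task \<pi>\<^sub>2 = {} \<and> user \<pi>\<^sub>1 \<inter> user \<pi>\<^sub>2 = {}"

definition plan_union :: "('s, 'u) plan \<Rightarrow> ('s, 'u) plan \<Rightarrow> ('s, 'u) plan" where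
  "plan_union \<pi>\<^sub>1 \<pi>\<^sub>2 =
     \<lparr>task = task \<pi>\<^sub>1 \<union> task \<pi>\<^sub>2,
      user = user \<pi>\<^sub>1 \<union> user \<pi>\<^sub>2,
      assign = (\<lambda>s. if s \<in> task \<pi>\<^sub>1 then assign \<pi>\<^sub>1 s else assign \<pi>\<^sub>2 s)\<rparr>"

definition extension_equivalence ::
  "'s set \<Rightarrow> 'u set \<Rightarrow> ('s, 'u) wsp_constraint set \<Rightarrow> (('s, 'u) plan \<times> ('s, 'u) plan) set" where
  "extension_equivalence S U C =
     {(\<pi>\<^sub>1, \<pi>\<^sub>2). \<pi>\<^sub>1 \<in> eligible_plans S U C \<and> \<pi>\<^sub>2 \<in> eligible_plans S U C \<and>
        user \<pi>\<^sub>1 = user \<pi>\<^sub>2 \<and> task \<pi>\<^sub>1 = task \<pi>\<^sub>2 \<and>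
        (\<forall>\<pi>'. is_plan S U \<pi>' \<and> disjoint_plans \<pi>\<^sub>1 \<pi>' \<and> disjoint_plans \<pi>\<^sub>2 \<pi>' \<longrightarrow>
           (eligible C (plan_union \<pi>\<^sub>1 \<pi>') \<longleftrightarrow> eligible C (plan_union \<pi>\<^sub>2 \<pi>')))}"

definition plan_indistinguishability ::
  "'s set \<Rightarrow> 'u set \<Rightarrow> ('s, 'u) wsp_constraint set \<Rightarrow>
   (('s, 'u) plan \<times> ('s, 'u) plan) set \<Rightarrow> bool" where
  "plan_indistinguishability S U C R \<longleftrightarrow>
     equiv (eligible_plans S U C) R \<and>
     R \<subseteq> extension_equivalence S U C \<and>
     (\<forall>\<pi>\<^sub>1 \<pi>\<^sub>2 \<pi>'. (\<pi>\<^sub>1, \<pi>\<^sub>2) \<in> R \<and> is_plan S U \<pi>' \<and>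
        disjoint_plans \<pi>\<^sub>1 \<pi>' \<and> disjoint_plans \<pi>\<^sub>2 \<pi>' \<and> eligible C (plan_union \<pi>\<^sub>1 \<pi>') \<longrightarrow>
        (plan_union \<pi>\<^sub>1 \<pi>', plan_union \<pi>\<^sub>2 \<pi>') \<in> R)"

text \<open>
  The list \<open>us\<close> enumerates the users, so \<open>set (take i us)\<close> is the set of the first \<open>i\<close> of them.
  Inserting \<open>0\<close> only matters when there are no users, where the maximum ranges over the empty set.
\<close>

definition plan_width ::
  "'s set \<Rightarrow> 'u set \<Rightarrow> ('s, 'u) wsp_constraint set \<Rightarrow> 'u list \<Rightarrow>
   (('s, 'u) plan \<times> ('s, 'u) plan) set \<Rightarrow> nat" where
  "plan_width S U C us R =
     Max (insert 0
       {card ({\<pi> \<in> eligible_plans S U C. user \<pi> = set (take i us) \<and> task \<pi> = T} // R) | i T.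
          i \<in> {1..length us} \<and> T \<subseteq> S})"

end

theory Submission
  imports Defs
begin

text \<open>Being eligible for \<open>C \<union> D\<close> means being eligible for both, so
  eligible plans, extension-equivalence and closure under disjoint unions can all be checked for
  \<open>C\<close> and \<open>D\<close> separately. The relation in question is simply the
  intersection of the two given relations, which yields plan-indistinguishability
  (\<open>plan_indistinguishability_Int\<close>). For the width, fix a user set and a task set: a
  class of the intersection is the intersection of one class of each relation, so it is determined
  by a pair of classes, and there are at most \<open>W\<^sub>1 * W\<^sub>2\<close> such pairs
  (\<open>card_quotient_Int_le\<close>, \<open>plan_width_Int_le\<close>).\<close>

lemma eligible_Un: "eligible (C \<union> D) \<pi> \<longleftrightarrow> eligible C \<pi> \<and> eligible D \<pi>"
  by (auto simp: eligible_def)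

lemma eligible_plans_Un: "eligible_plans S U (C \<union> D) = eligible_plans S U C \<inter> eligible_plans S U D"
  by (auto simp: eligible_plans_def eligible_Un)

text \<open>Assignments are extensional, so a plan is determined by its values on its finite task
  set. This makes the quotients below finite, so that \<open>card\<close> really counts their
  classes.\<close>

lemma finite_plans:
  assumes "finite S" "finite U"
  shows "finite {\<pi> :: ('s, 'u) plan. is_plan S U \<pi>}"
proof (rule finite_subset)
  let ?f = "\<lambda>(T, X, f). \<lparr>task = T, user = X, assign = f\<rparr> :: ('s, 'u) plan"
  let ?P = "SIGMA T:Pow S. SIGMA X:Pow U. T \<rightarrow>\<^sub>E X"
  show "{\<pi>. is_plan S U \<pi>} \<subseteq> ?f ` ?P"
  proof
    fix \<pi> :: "('s, 'u) plan"
    assume "\<pi> \<in> {\<pi>. is_plan S U \<pi>}"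
    then have "(task \<pi>, user \<pi>, assign \<pi>) \<in> ?P"
      by (auto simp: is_plan_def)
    then show "\<pi> \<in> ?f ` ?P"
      by (rule rev_image_eqI) simp
  qed
  show "finite (?f ` ?P)"
    using assms by (intro finite_imageI finite_SigmaI finite_PiE) (auto dest: finite_subset)
qed

text \<open>For each extension the two equivalences of eligibility, one for \<open>C\<close> and one
  for \<open>D\<close>, combine into an equivalence of the conjunctions.\<close>

lemma extension_equivalence_Un:
  assumes "(\<pi>, \<pi>') \<in> extension_equivalence S U C" "(\<pi>, \<pi>') \<in> extension_equivalence S U D"
  shows "(\<pi>, \<pi>') \<in> extension_equivalence S U (C \<union> D)"
  using assms unfolding extension_equivalence_def by (auto simp: eligible_plans_Un eligible_Un)

lemma equiv_Int:
  assumes "equiv A r" "equiv B s"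
  shows "equiv (A \<inter> B) (r \<inter> s)"
  using assms
  by (auto simp: equiv_def refl_on_def intro: sym_Int trans_Int)

lemma plan_indistinguishability_Int:
  assumes 1: "plan_indistinguishability S U C R" and 2: "plan_indistinguishability S U D Q"
  shows "plan_indistinguishability S U (C \<union> D) (R \<inter> Q)"
  unfolding plan_indistinguishability_def
proof (intro conjI allI impI)
  show "equiv (eligible_plans S U (C \<union> D)) (R \<inter> Q)"
    using assms by (simp add: plan_indistinguishability_def eligible_plans_Un equiv_Int)
  show "R \<inter> Q \<subseteq> extension_equivalence S U (C \<union> D)"
    using assms by (auto simp: plan_indistinguishability_def intro!: extension_equivalence_Un)
next
  fix \<pi>\<^sub>1 \<pi>\<^sub>2 \<pi>'
  assume *: "(\<pi>\<^sub>1, \<pi>\<^sub>2) \<in> R \<inter> Q \<and> is_plan S U \<pi>' \<and> disjoint_plans \<pi>\<^sub>1 \<pi>' \<and>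
    disjoint_plans \<pi>\<^sub>2 \<pi>' \<and> eligible (C \<union> D) (plan_union \<pi>\<^sub>1 \<pi>')"
  \<comment> \<open>The extended plan is eligible for \<open>C \<union> D\<close>, hence for each
    set alone, so the closure property of each relation applies.\<close>
  then have "(plan_union \<pi>\<^sub>1 \<pi>', plan_union \<pi>\<^sub>2 \<pi>') \<in> R"
    using 1 unfolding plan_indistinguishability_def eligible_Un by blast
  moreover from * have "(plan_union \<pi>\<^sub>1 \<pi>', plan_union \<pi>\<^sub>2 \<pi>') \<in> Q"
    using 2 unfolding plan_indistinguishability_def eligible_Un by blast
  ultimately show "(plan_union \<pi>\<^sub>1 \<pi>', plan_union \<pi>\<^sub>2 \<pi>') \<in> R \<inter> Q" by blast
qed

text \<open>\<open>Max\<close> is a genuine maximum only over a finite set; here the index pairs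
  range over a finite product.\<close>

lemma finite_plan_class_counts:
  assumes "finite S"
  shows "finite {card ({\<pi> \<in> eligible_plans S U C. user \<pi> = set (take i us) \<and> task \<pi> = T} // R) | i T.
          i \<in> {1..length us} \<and> T \<subseteq> S}"
proof -
  have "finite ((\<lambda>(i, T). card ({\<pi> \<in> eligible_plans S U C. user \<pi> = set (take i us) \<and> task \<pi> = T} // R))
          ` ({1..length us} \<times> Pow S))"
    using assms by simp
  then show ?thesis
    by (rule rev_finite_subset) auto
qed

lemma card_classes_le_plan_width:
  assumes "finite S" "i \<in> {1..length us}" "T \<subseteq> S"
  shows "card ({\<pi> \<in> eligible_plans S U C. user \<pi> = set (take i us) \<and> task \<pi> = T} // R)
    \<le> plan_width S U C us R"
  unfolding plan_width_def
  using assms finite_plan_class_counts[OF assms(1)] by (intro Max_ge) auto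

text \<open>The image of a point under \<open>R \<inter> Q\<close> is the intersection of its images
  under \<open>R\<close> and \<open>Q\<close>. Hence intersecting maps the pairs of classes onto a
  set containing all classes of \<open>R \<inter> Q\<close>.\<close>

lemma card_quotient_Int_le:
  assumes "finite (X // R)" "finite (Y // Q)"
  shows "card ((X \<inter> Y) // (R \<inter> Q)) \<le> card (X // R) * card (Y // Q)"
proof -
  have "(X \<inter> Y) // (R \<inter> Q) \<subseteq> (\<lambda>(K, L). K \<inter> L) ` ((X // R) \<times> (Y // Q))"
  proof
    fix K assume "K \<in> (X \<inter> Y) // (R \<inter> Q)"
    then obtain x where x: "x \<in> X" "x \<in> Y" and K: "K = (R \<inter> Q) `` {x}"
      by (auto elim: quotientE)
    have "K = (\<lambda>(K, L). K \<inter> L) (R `` {x}, Q `` {x})"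
      by (auto simp: K)
    then show "K \<in> (\<lambda>(K, L). K \<inter> L) ` ((X // R) \<times> (Y // Q))"
      using x by (blast intro: quotientI)
  qed
  then have "card ((X \<inter> Y) // (R \<inter> Q)) \<le> card ((X // R) \<times> (Y // Q))"
    using assms by (intro surj_card_le) auto
  then show ?thesis
    by (simp add: card_cartesian_product)
qed

lemma plan_width_Int_le:
  assumes "finite S" "finite U"
  shows "plan_width S U (C \<union> D) us (R \<inter> Q) \<le> plan_width S U C us R * plan_width S U D us Q"
proof -
  let ?X = "\<lambda>C i T. {\<pi> \<in> eligible_plans S U C. user \<pi> = set (take i us) \<and> task \<pi> = T}"
  have "card (?X (C \<union> D) i T // (R \<inter> Q)) \<le> plan_width S U C us R * plan_width S U D us Q"
    if "i \<in> {1..length us}" "T \<subseteq> S" for i T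
  proof -
    \<comment> \<open>Stated for arbitrary \<open>E\<close> and \<open>P\<close> so that it serves
      both factors.\<close>
    have fin: "finite (?X E i T // P)" for E :: "('a, 'b) wsp_constraint set" and P
    proof -
      have "finite (?X E i T)"
        by (rule finite_subset[OF _ finite_plans[OF assms]]) (auto simp: eligible_plans_def)
      then show ?thesis
        by (auto simp: quotient_def)
    qed
    have "?X (C \<union> D) i T = ?X C i T \<inter> ?X D i T"
      by (auto simp: eligible_plans_Un)
    then have "card (?X (C \<union> D) i T // (R \<inter> Q)) \<le> card (?X C i T // R) * card (?X D i T // Q)"
      using card_quotient_Int_le[OF fin fin] by simp
    also have "\<dots> \<le> plan_width S U C us R * plan_width S U D us Q"
      using assms that by (intro mult_le_mono card_classes_le_plan_width)
    finally show ?thesis .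
  qed
  then show ?thesis
    \<comment> \<open>Only the width on the left is unfolded; the product stays as an upper bound
      for every class count and for the inserted \<open>0\<close>.\<close>
    unfolding plan_width_def[of S U "C \<union> D"]
    using finite_plan_class_counts[OF assms(1)] by (intro Max.boundedI) auto
qed

theorem theorem21:
  fixes S :: "'s set" and U :: "'u set" and A :: "'s \<Rightarrow> 'u set"
    and C\<^sub>1 C\<^sub>2 :: "('s, 'u) wsp_constraint set"
    and R\<^sub>1 R\<^sub>2 R :: "(('s, 'u) plan \<times> ('s, 'u) plan) set"
    and us :: "'u list" and W\<^sub>1 W\<^sub>2 :: nat
  assumes "wsp_instance S U A (C\<^sub>1 \<union> C\<^sub>2)"
    and "plan_indistinguishability S U C\<^sub>1 R\<^sub>1"
    and "plan_indistinguishability S U C\<^sub>2 R\<^sub>2"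
    and "distinct us" and "set us = U"
    and "W\<^sub>1 = plan_width S U C\<^sub>1 us R\<^sub>1"
    and "W\<^sub>2 = plan_width S U C\<^sub>2 us R\<^sub>2"
    and "R = {(\<pi>, \<pi>'). \<pi> \<in> eligible_plans S U (C\<^sub>1 \<union> C\<^sub>2) \<and> \<pi>' \<in> eligible_plans S U (C\<^sub>1 \<union> C\<^sub>2) \<and>
                (\<pi>, \<pi>') \<in> R\<^sub>1 \<and> (\<pi>, \<pi>') \<in> R\<^sub>2}"
  shows "plan_indistinguishability S U (C\<^sub>1 \<union> C\<^sub>2) R \<and>
         plan_width S U (C\<^sub>1 \<union> C\<^sub>2) us R \<le> W\<^sub>1 * W\<^sub>2"
proof -
  \<comment> \<open>A pair in both relations consists of plans eligible for both constraint sets,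
    which identifies \<open>R\<close> with \<open>R\<^sub>1 \<inter> R\<^sub>2\<close>.\<close>
  have "R\<^sub>1 \<subseteq> eligible_plans S U C\<^sub>1 \<times> eligible_plans S U C\<^sub>1"
    and "R\<^sub>2 \<subseteq> eligible_plans S U C\<^sub>2 \<times> eligible_plans S U C\<^sub>2"
    using assms(2,3) by (auto simp: plan_indistinguishability_def extension_equivalence_def)
  then have "R = R\<^sub>1 \<inter> R\<^sub>2"
    unfolding assms(8) by (auto simp: eligible_plans_Un)
  moreover have "finite S" "finite U"
    using assms(1) by (auto simp: wsp_instance_def)
  ultimately show ?thesis
    using assms by (simp add: plan_indistinguishability_Int plan_width_Int_le)
qed

end
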